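(* Let $G$ be a connected graph of order $n\geq 3$. Then $rx_3(G)=n-1$ if and only if $G$ is a tree or $G$ is a unicyclic graph with girth $3$.
   Context: All graphs are simple, finite and undirected. For a nontrivial connected graph $G$, an edge-coloring $c:E(G)\to\{1,\dots,q\}$ (adjacent edges may receive the same color) is given. A tree $T$ in $G$ is a rainbow tree if no two edges of $T$ receive the same color. For $S\subseteq V(G)$, an $S$-tree is a tree in $G$ containing all vertices of $S$. The coloring is a $3$-rainbow coloring if for every $3$-element subset $S$ of $V(G)$ there is a rainbow $S$-tree. The $3$-rainbow index $rx_3(G)$ is the minimum number of colors in a $3$-rainbow coloring of $G$. A unicyclic graph is a connected graph with exactly as many edges as vertices (i.e., containing exactly one cycle); its girth is the length of that cycle. *)

theory Defs
  imports Main "HOL-Library.FuncSet" "HOL-Library.Extended_Nat"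
begin

definition simple_graph :: "'a set \<Rightarrow> 'a set set \<Rightarrow> bool" where
  "simple_graph V E \<longleftrightarrow> finite V \<and> (\<forall>e\<in>E. e \<subseteq> V \<and> card e = 2)"

text \<open>The empty graph is not counted as connected, so trees are nonempty.\<close>

definition connected_graph :: "'a set \<Rightarrow> 'a set set \<Rightarrow> bool" where
  "connected_graph V E \<longleftrightarrow>
     simple_graph V E \<and> V \<noteq> {} \<and> (\<forall>u\<in>V. \<forall>v\<in>V. (u, v) \<in> {(x, y). {x, y} \<in> E}\<^sup>*)"

text \<open>A cycle is given by the list of its vertices in cyclic order, without repeating the
  first vertex at the end; the length of the list is the length of the cycle.\<close>

definition cycle :: "'a set set \<Rightarrow> 'a list \<Rightarrow> bool" where
  "cycle E p \<longleftrightarrow>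
     length p \<ge> 3 \<and> distinct p \<and>
     (\<forall>i<length p. {p ! i, p ! (Suc i mod length p)} \<in> E)"

definition tree :: "'a set \<Rightarrow> 'a set set \<Rightarrow> bool" where
  "tree V E \<longleftrightarrow> connected_graph V E \<and> (\<nexists>p. cycle E p)"

definition unicyclic :: "'a set \<Rightarrow> 'a set set \<Rightarrow> bool" where
  "unicyclic V E \<longleftrightarrow> connected_graph V E \<and> card E = card V"

text \<open>The girth is the length of a shortest cycle, infinite if there is none. In a unicyclic
  graph this is the length of its only cycle.\<close>

definition girth :: "'a set set \<Rightarrow> enat" where
  "girth E = (INF p\<in>{p. cycle E p}. enat (length p))"

definition rainbow :: "('a set \<Rightarrow> nat) \<Rightarrow> 'a set set \<Rightarrow> bool" where
  "rainbow c F \<longleftrightarrow> inj_on c F"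

text \<open>Trees in the graph are arbitrary subgraphs, not necessarily induced or spanning.\<close>

definition steiner_tree :: "'a set \<Rightarrow> 'a set set \<Rightarrow> 'a set \<Rightarrow> 'a set \<Rightarrow> 'a set set \<Rightarrow> bool" where
  "steiner_tree V E S W F \<longleftrightarrow> W \<subseteq> V \<and> F \<subseteq> E \<and> tree W F \<and> S \<subseteq> W"

definition three_rainbow_coloring ::
    "'a set \<Rightarrow> 'a set set \<Rightarrow> nat \<Rightarrow> ('a set \<Rightarrow> nat) \<Rightarrow> bool" where
  "three_rainbow_coloring V E q c \<longleftrightarrow>
     c \<in> E \<rightarrow> {1..q} \<and>
     (\<forall>S. S \<subseteq> V \<and> card S = 3 \<longrightarrow> (\<exists>W F. steiner_tree V E S W F \<and> rainbow c F))"

definition rx3 :: "'a set \<Rightarrow> 'a set set \<Rightarrow> nat" where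
  "rx3 V E = (LEAST q. \<exists>c. three_rainbow_coloring V E q c)"

end

theory Submission
  imports Defs
begin

text \<open>A rainbow \<open>S\<close>-tree exists iff some rainbow edge set connects \<open>S\<close>, since a connected graph
  contains a spanning tree; so trees may be replaced by connected edge sets throughout.

  Lower bound: two bridges with far apart ends \<open>a\<close>, \<open>d\<close> both lie on every tree through \<open>a\<close> and
  \<open>d\<close>, so bridges have pairwise distinct colours. This settles trees. In a unicyclic graph with
  triangle \<open>C\<close>, removing two edges of \<open>C\<close> disconnects the graph; if at most one colour on \<open>C\<close> were
  new, three vertices could be chosen so that a rainbow tree through them misses two edges of \<open>C\<close>
  whose removal separates the chosen vertices.

  Upper bound: a spanning tree needs at most \<open>n - 1\<close> colours. A cycle of length at least 4
  contracts to a 4-cycle coloured 1, 2, 1, 2, which saves two out of \<open>n\<close> edges. If all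
  cycles are triangles and there are more than \<open>n\<close> edges, there are two triangles sharing at most one
  vertex; contracting to a bowtie and using the colours 1, 2, 3 on both triangles saves three out
  of \<open>n + 1\<close>.\<close>

section \<open>Connection by edge sets\<close>

text \<open>The relation inside \<open>connected_graph\<close>, for an arbitrary edge set and
  without a vertex set, so that deleting or adding edges needs no bookkeeping of vertices.\<close>

definition joined :: "'a set set \<Rightarrow> 'a \<Rightarrow> 'a \<Rightarrow> bool" where
  "joined F u v \<longleftrightarrow> (u, v) \<in> {(x, y). {x, y} \<in> F}\<^sup>*"

lemma joined_refl [simp]: "joined F u u"
  by (simp add: joined_def)

lemma joined_trans: "joined F u v \<Longrightarrow> joined F v w \<Longrightarrow> joined F u w"
  unfolding joined_def by (rule rtrancl_trans)

lemma joined_edge: "{u, v} \<in> F \<Longrightarrow> joined F u v"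
  unfolding joined_def by auto

lemma joined_induct [consumes 1, case_names refl step]:
  assumes "joined F u v" "P u"
    and "\<And>v w. joined F u v \<Longrightarrow> P v \<Longrightarrow> {v, w} \<in> F \<Longrightarrow> P w"
  shows "P v"
  using assms(1) unfolding joined_def
proof (induction rule: rtrancl_induct)
  case base show ?case by (rule assms(2))
next
  case (step y z)
  then show ?case using assms(3)[of y z] by (auto simp: joined_def)
qed

text \<open>A walk in \<open>F\<close> survives in \<open>G\<close> if each of its edges can be
  rerouted in \<open>G\<close>. Monotonicity and the deletion of a bypassed edge are
  instances.\<close>

lemma joined_bind:
  assumes "joined F u v" and "\<And>x y. {x, y} \<in> F \<Longrightarrow> joined G x y"
  shows "joined G u v"
  using assms(1)
proof (induction rule: joined_induct)
  case refl show ?case by simp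
next
  case (step v w) then show ?case using assms(2) joined_trans by metis
qed

lemma joined_mono: "joined F u v \<Longrightarrow> F \<subseteq> G \<Longrightarrow> joined G u v"
  by (rule joined_bind) (auto intro: joined_edge)

lemma joined_sym: "joined F u v \<Longrightarrow> joined F v u"
proof (induction rule: joined_induct)
  case refl show ?case by simp
next
  case (step v w)
  have "joined F w v" using step.hyps(2) by (intro joined_edge) (simp add: insert_commute)
  then show ?case using step.IH joined_trans by metis
qed

text \<open>One crossing of the new edge suffices: between two crossings in opposite directions the
  walk returns to its starting end, and two in the same direction shortcut to one.\<close>

lemma joined_insertD:
  assumes "joined (insert {a, b} F) x y"
  shows "joined F x y \<or> joined F x a \<and> joined F b y \<or> joined F x b \<and> joined F a y"
  using assms
proof (induction rule: joined_induct)
  case refl show ?case by simp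
next
  case (step v w)
  show ?case
  proof (cases "{v, w} \<in> F")
    case True
    then show ?thesis using step.IH joined_edge joined_trans by metis
  next
    case False
    then have "v = a \<and> w = b \<or> v = b \<and> w = a" using step.hyps(2) by (auto simp: doubleton_eq_iff)
    then show ?thesis using step.IH by auto
  qed
qed

lemma joined_remove:
  assumes "joined F x y" "joined (F - {{a, b}}) a b"
  shows "joined (F - {{a, b}}) x y"
  using assms(1)
proof (rule joined_bind)
  fix u v assume "{u, v} \<in> F"
  then show "joined (F - {{a, b}}) u v"
    using assms(2) joined_sym[OF assms(2)]
    by (cases "{u, v} = {a, b}") (auto simp: doubleton_eq_iff intro: joined_edge)
qed

lemma connected_graphD:
  assumes "connected_graph V E"
  shows "finite V" "V \<noteq> {}" "finite E" "\<And>e. e \<in> E \<Longrightarrow> e \<subseteq> V" "\<And>e. e \<in> E \<Longrightarrow> card e = 2"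
    "\<And>u v. u \<in> V \<Longrightarrow> v \<in> V \<Longrightarrow> joined E u v"
proof -
  show fV: "finite V" and "V \<noteq> {}" and eV: "\<And>e. e \<in> E \<Longrightarrow> e \<subseteq> V" and "\<And>e. e \<in> E \<Longrightarrow> card e = 2"
    and "\<And>u v. u \<in> V \<Longrightarrow> v \<in> V \<Longrightarrow> joined E u v"
    using assms unfolding connected_graph_def simple_graph_def joined_def by auto
  have "E \<subseteq> Pow V" using eV by auto
  then show "finite E" using fV finite_subset by blast
qed

lemma connected_edgeE:
  assumes "connected_graph V E" "e \<in> E"
  obtains a b where "e = {a, b}" "a \<noteq> b" "a \<in> V" "b \<in> V"
  using connected_graphD(4,5)[OF assms] by (auto simp: card_2_iff)

lemma connected_graphI:
  assumes "connected_graph V E" "F \<subseteq> E" "\<And>u v. u \<in> V \<Longrightarrow> v \<in> V \<Longrightarrow> joined F u v"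
  shows "connected_graph V F"
  using assms unfolding connected_graph_def simple_graph_def joined_def by blast

section \<open>Paths and cycles\<close>

lemma distinct_path:
  assumes "joined F u v"
  shows "\<exists>p m. length p = Suc m \<and> p ! 0 = u \<and> p ! m = v \<and> distinct p \<and>
    (\<forall>i<m. {p ! i, p ! Suc i} \<in> F)"
  using assms
proof (induction rule: joined_induct)
  case refl
  show ?case by (rule exI[of _ "[u]"]) simp
next
  case (step v w)
  then obtain p m where p: "length p = Suc m" "p ! 0 = u" "p ! m = v" "distinct p"
    "\<forall>i<m. {p ! i, p ! Suc i} \<in> F" by blast
  have edge: "{v, w} \<in> F" by fact
  show ?case
  proof (cases "w \<in> set p")
    case True
    then obtain k where "k < length p" "p ! k = w" by (auto simp: in_set_conv_nth)
    then have k: "k \<le> m" "p ! k = w" using p(1) by simp_all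
    \<comment> \<open>The walk has come back to its path, which is cut off at
      \<open>w\<close>.\<close>
    show ?thesis
      by (rule exI[of _ "take (Suc k) p"], rule exI[of _ k]) (use p k in auto)
  next
    case False
    show ?thesis
      by (rule exI[of _ "p @ [w]"], rule exI[of _ "Suc m"])
        (use p edge False in \<open>auto simp: nth_append less_Suc_eq\<close>)
  qed
qed

text \<open>The hypotheses on \<open>{u, v}\<close> exclude paths with no edge or one edge, so at
  least three vertices remain. The positions of \<open>u\<close> and \<open>v\<close> are recorded
  so that a cycle closed by a chosen edge is known to contain both of its ends.\<close>

lemma path_closes_to_cycle:
  assumes "joined F u v" "u \<noteq> v" "{u, v} \<notin> F"
  shows "\<exists>p. cycle (insert {u, v} F) p \<and> p ! 0 = u \<and> p ! (length p - 1) = v"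
proof -
  obtain p m where p: "length p = Suc m" "p ! 0 = u" "p ! m = v" "distinct p"
    "\<forall>i<m. {p ! i, p ! Suc i} \<in> F" using distinct_path[OF assms(1)] by blast
  have "m \<noteq> 0" using p(2,3) assms(2) by (cases m) auto
  moreover have "m \<noteq> 1" using p(2,3,5) assms(3) by auto
  ultimately have "m \<ge> 2" by linarith
  have "{p ! i, p ! (Suc i mod length p)} \<in> insert {u, v} F" if "i < length p" for i
  proof (cases "i = m")
    case True then show ?thesis using p(1,2,3) by (simp add: insert_commute)
  next
    case False then show ?thesis using p(1,5) that by simp
  qed
  then have "cycle (insert {u, v} F) p"
    unfolding cycle_def using p(1,4) \<open>m \<ge> 2\<close> by simp
  then show ?thesis using p by (intro exI[of _ p]) auto
qed

lemma cycle_remove_edge: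
  assumes "cycle E p"
  defines "e \<equiv> {p ! 0, p ! (length p - 1)}"
  shows "e \<in> E" "joined (E - {e}) (p ! 0) (p ! (length p - 1))"
proof -
  let ?n = "length p"
  have n: "?n \<ge> 3" and d: "distinct p" and ed: "\<And>i. i < ?n \<Longrightarrow> {p ! i, p ! (Suc i mod ?n)} \<in> E"
    using assms(1) unfolding cycle_def by auto
  show "e \<in> E" using ed[of "?n - 1"] n by (cases "?n") (auto simp: e_def insert_commute)
  have "j < ?n \<Longrightarrow> joined (E - {e}) (p ! 0) (p ! j)" for j
  proof (induction j)
    case 0 show ?case by simp
  next
    case (Suc j)
    \<comment> \<open>Consecutive positions \<open>j\<close>, \<open>Suc j\<close> are never 0 and
      \<open>?n - 1\<close>, because \<open>?n\<close> is at least 3; so the rest of the cycle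
      avoids \<open>e\<close>.\<close>
    have "{p ! j, p ! Suc j} \<noteq> e"
      unfolding e_def doubleton_eq_iff using Suc.prems n
      by (subst (1 2 3 4) nth_eq_iff_index_eq[OF d]) auto
    then have "joined (E - {e}) (p ! j) (p ! Suc j)"
      using ed[of j] Suc.prems by (intro joined_edge) auto
    then show ?case using Suc joined_trans by (metis Suc_lessD)
  qed
  then show "joined (E - {e}) (p ! 0) (p ! (?n - 1))" using n by simp
qed

section \<open>Spanning trees, edge counts and forests grown from a vertex set\<close>

lemma spanning_tree_exists:
  assumes "connected_graph V E"
  shows "\<exists>T\<subseteq>E. tree V T"
  using connected_graphD(3)[OF assms] assms
proof (induction E rule: finite_psubset_induct)
  case (psubset E)
  show ?case
  proof (cases "\<exists>p. cycle E p")
    case False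
    then show ?thesis using psubset by (auto simp: tree_def)
  next
    case True
    then obtain p where p: "cycle E p" by blast
    define a b where "a = p ! 0" and "b = p ! (length p - 1)"
    have ab: "{a, b} \<in> E" "joined (E - {{a, b}}) a b"
      using cycle_remove_edge[OF p] by (simp_all add: a_def b_def)
    have "connected_graph V (E - {{a, b}})"
      using psubset.prems
      by (rule connected_graphI) (auto intro!: joined_remove ab connected_graphD(6)[OF psubset.prems])
    then have "\<exists>T\<subseteq>E - {{a, b}}. tree V T" using psubset.IH ab(1) by blast
    then show ?thesis by blast
  qed
qed

text \<open>\<open>R\<close> holds vertices of pairwise different components. Each edge merges at
  most two components, so at least \<open>card V - card F\<close> of them remain.\<close>

lemma joined_independent_set:
  assumes "finite F" "finite V" "\<And>e. e \<in> F \<Longrightarrow> card e = 2"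
  shows "\<exists>R\<subseteq>V. card V \<le> card F + card R \<and> (\<forall>u\<in>R. \<forall>v\<in>R. joined F u v \<longrightarrow> u = v)"
  using assms(1,3)
proof (induction F rule: finite_induct)
  case empty
  have "u = v" if "joined {} u v" for u v :: 'a
    using that by (induction rule: joined_induct) auto
  then show ?case by auto
next
  case (insert e F)
  then obtain R where R: "R \<subseteq> V" "card V \<le> card F + card R"
    "\<forall>u\<in>R. \<forall>v\<in>R. joined F u v \<longrightarrow> u = v" by auto
  have fR: "finite R" using R(1) assms(2) finite_subset by blast
  obtain a b where e: "e = {a, b}" using insert.prems[of e] by (auto simp: card_2_iff)
  \<comment> \<open>A connection made possible only by \<open>e\<close> has one of its ends in the
    component of \<open>a\<close>, and at most one member of \<open>R\<close> lies there; dropping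
    it is enough.\<close>
  define A where "A = {r \<in> R. joined F r a}"
  have "r = s" if "r \<in> A" "s \<in> A" for r s
    using that R(3) joined_sym joined_trans unfolding A_def by fast
  then have A: "card A \<le> 1" using fR by (auto simp: A_def card_le_Suc0_iff_eq)
  have "card (R - A) = card R - card A" using fR by (intro card_Diff_subset) (auto simp: A_def)
  then have "card V \<le> card (insert e F) + card (R - A)" using R(2) A insert.hyps by simp
  moreover have "u = v" if "u \<in> R - A" "v \<in> R - A" "joined (insert e F) u v" for u v
    using R(3) joined_insertD[OF that(3)[unfolded e]] joined_sym[of F a v] that(1,2)
    unfolding A_def by auto
  ultimately show ?case using R(1) by (intro exI[of _ "R - A"]) auto
qed

lemma connected_card_edges:
  assumes "connected_graph V E"
  shows "card V \<le> card E + 1"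
proof -
  note D = connected_graphD[OF assms]
  obtain R where R: "R \<subseteq> V" "card V \<le> card E + card R" "\<forall>u\<in>R. \<forall>v\<in>R. joined E u v \<longrightarrow> u = v"
    using joined_independent_set[OF D(3,1)] D(5) by auto
  have "u = v" if "u \<in> R" "v \<in> R" for u v using that R(1,3) D(6) by blast
  moreover have "finite R" using R(1) D(1) finite_subset by blast
  ultimately have "card R \<le> 1" by (simp add: card_le_Suc0_iff_eq)
  then show ?thesis using R(2) by linarith
qed

lemma connected_leaving_edge:
  assumes "connected_graph V E" "w \<in> V" "P w" "v \<in> V" "\<not> P v"
  shows "\<exists>a b. {a, b} \<in> E \<and> P a \<and> \<not> P b"
proof (rule ccontr)
  assume no: "\<not> ?thesis"
  have "joined E w v" using connected_graphD(6)[OF assms(1)] assms by blast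
  then have "P v"
  proof (induction rule: joined_induct)
    case refl show ?case by (rule assms(3))
  next
    case (step x y) then show ?case using no by blast
  qed
  then show False using assms(5) by simp
qed

text \<open>Vertices outside \<open>W\<close> are attached one at a time, each by an edge leaving
  the part already reached. Since no edge of \<open>X\<close> lies inside \<open>W\<close>,
  \<open>X\<close> stays disjoint from the edges of a cycle or triangle on \<open>W\<close> and can
  be contracted onto it.\<close>

lemma growing_forest:
  assumes "connected_graph V E" "W \<subseteq> V" "W \<noteq> {}"
  shows "\<exists>X\<subseteq>E. card X \<le> card V - card W \<and> (\<forall>e\<in>X. \<not> e \<subseteq> W) \<and> (\<forall>v\<in>V. \<exists>w\<in>W. joined X v w)"
  using assms(2,3)
proof (induction "card V - card W" arbitrary: W rule: less_induct)
  case less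
  note D = connected_graphD[OF assms(1)]
  show ?case
  proof (cases "W = V")
    case True
    then show ?thesis by (intro exI[of _ "{}"]) (auto intro: joined_refl)
  next
    case False
    then obtain v w where "v \<in> V" "v \<notin> W" "w \<in> W" using less.prems by blast
    then obtain a b where ab: "{a, b} \<in> E" "a \<in> W" "b \<notin> W"
      using connected_leaving_edge[OF assms(1), of w "\<lambda>x. x \<in> W" v] less.prems by blast
    have b: "b \<in> V" using D(4)[OF ab(1)] by simp
    have fW: "finite W" using less.prems D(1) finite_subset by blast
    have "card (insert b W) \<le> card V" using b less.prems D(1) by (intro card_mono) auto
    then have lt: "card (insert b W) = Suc (card W)" "card W < card V" using fW ab by auto
    then have lt2: "card V - card (insert b W) < card V - card W" by linarith
    have sub: "insert b W \<subseteq> V" "insert b W \<noteq> {}" using b less.prems by auto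
    obtain X where X: "X \<subseteq> E" "card X \<le> card V - card (insert b W)"
      "\<forall>e\<in>X. \<not> e \<subseteq> insert b W" "\<forall>v\<in>V. \<exists>w\<in>insert b W. joined X v w"
      using less.hyps[OF lt2 sub] by blast
    let ?X = "insert {a, b} X"
    have "finite X" using X(1) D(3) finite_subset by blast
    then have "card ?X \<le> Suc (card X)" by (simp add: card_insert_if)
    then have "card ?X \<le> card V - card W" using X(2) lt by linarith
    moreover have "\<exists>w\<in>W. joined ?X v w" if "v \<in> V" for v
    proof -
      obtain w where w: "w \<in> insert b W" "joined X v w" using X(4) \<open>v \<in> V\<close> by blast
      have vw: "joined ?X v w" using w(2) joined_mono by (metis subset_insertI)
      have "joined ?X b a" by (intro joined_edge) (auto simp: insert_commute)
      then show ?thesis using w(1) vw ab(2) joined_trans by (metis insertE)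
    qed
    ultimately show ?thesis using X ab by (intro exI[of _ ?X]) auto
  qed
qed

section \<open>Colourings\<close>

definition joins :: "'a set set \<Rightarrow> 'a set \<Rightarrow> bool" where
  "joins F S \<longleftrightarrow> (\<forall>u\<in>S. \<forall>v\<in>S. joined F u v)"

lemma joinsI: "(\<And>s. s \<in> S \<Longrightarrow> joined F s r) \<Longrightarrow> joins F S"
  unfolding joins_def using joined_sym joined_trans by metis

text \<open>The component of one vertex of \<open>S\<close> in \<open>F\<close> is a connected graph
  that contains \<open>S\<close>; its spanning tree inherits rainbowness from
  \<open>F\<close>.\<close>

lemma steiner_tree_exists:
  assumes "connected_graph V E" "F \<subseteq> E" "S \<subseteq> V" "S \<noteq> {}" "joins F S"
  shows "\<exists>W T. steiner_tree V E S W T \<and> T \<subseteq> F"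
proof -
  note D = connected_graphD[OF assms(1)]
  obtain s where s: "s \<in> S" using assms(4) by blast
  define W where "W = {v \<in> V. joined F s v}"
  define F' where "F' = {e \<in> F. e \<subseteq> W}"
  have sW: "s \<in> W" using s assms(3) by (auto simp: W_def)
  have *: "joined F' s v" if "joined F s v" for v
    using that
  proof (induction rule: joined_induct)
    case refl show ?case by simp
  next
    case (step v w)
    have "joined F s w" using step.hyps joined_edge joined_trans by metis
    moreover have "{v, w} \<subseteq> V" using D(4) assms(2) step.hyps(2) by blast
    ultimately have "{v, w} \<in> F'" using step.hyps unfolding F'_def W_def by auto
    then show ?case using step.IH joined_edge joined_trans by metis
  qed
  have "connected_graph W F'"
    unfolding connected_graph_def simple_graph_def
  proof (intro conjI ballI)
    show "finite W" using D(1) by (simp add: W_def)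
    show "W \<noteq> {}" using sW by blast
    fix e assume "e \<in> F'"
    then show "e \<subseteq> W" "card e = 2" using D(5) assms(2) by (auto simp: F'_def)
  next
    fix u v assume "u \<in> W" "v \<in> W"
    then have "joined F' s u" "joined F' s v" using * by (auto simp: W_def)
    then show "(u, v) \<in> {(x, y). {x, y} \<in> F'}\<^sup>*"
      using joined_sym joined_trans unfolding joined_def[symmetric] by metis
  qed
  then obtain T where "T \<subseteq> F'" "tree W T" using spanning_tree_exists by blast
  moreover have "S \<subseteq> W" using assms(3,5) s by (auto simp: W_def joins_def)
  ultimately have "steiner_tree V E S W T" "T \<subseteq> F"
    using assms(2) unfolding steiner_tree_def by (auto simp: W_def F'_def)
  then show ?thesis by blast
qed

lemma steiner_tree_joins:
  assumes "steiner_tree V E S W F"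
  shows "F \<subseteq> E" "joins F S"
  using assms unfolding steiner_tree_def tree_def joins_def
  by (auto dest: connected_graphD(6))

text \<open>Colours may be of any type and need only be given on \<open>E'\<close>: an injection
  \<open>h\<close> renames those that occur. The constructions below use edges as colours.\<close>

lemma coloring_exists:
  assumes "connected_graph V E" "E' \<subseteq> E" "card (c ` E') \<le> q" "q \<ge> 1"
    and "\<And>S. S \<subseteq> V \<Longrightarrow> card S = 3 \<Longrightarrow> \<exists>F\<subseteq>E'. inj_on c F \<and> joins F S"
  shows "\<exists>c'. three_rainbow_coloring V E q c'"
proof -
  have "finite E'" using connected_graphD(3)[OF assms(1)] assms(2) finite_subset by blast
  then have "finite (c ` E')" by simp
  then obtain h where h: "h ` (c ` E') \<subseteq> {1..q}" "inj_on h (c ` E')"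
    using card_le_inj[of "c ` E'" "{1..q}"] assms(3) by auto
  \<comment> \<open>Edges outside \<open>E'\<close> occur in none of the chosen trees, so they take
    the colour 1, which is in range by \<open>q \<ge> 1\<close>.\<close>
  define c' where "c' e = (if e \<in> E' then h (c e) else 1)" for e
  have "three_rainbow_coloring V E q c'"
    unfolding three_rainbow_coloring_def
  proof (intro conjI allI impI)
    show "c' \<in> E \<rightarrow> {1..q}"
    proof
      fix e assume "e \<in> E"
      show "c' e \<in> {1..q}"
      proof (cases "e \<in> E'")
        case True
        then have "h (c e) \<in> h ` c ` E'" by simp
        then have "h (c e) \<in> {1..q}" using h(1) by (rule rev_subsetD)
        then show ?thesis using True by (simp add: c'_def)
      qed (use assms(4) in \<open>simp add: c'_def\<close>)
    qed
    fix S assume S: "S \<subseteq> V \<and> card S = 3"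
    then obtain F where F: "F \<subseteq> E'" "inj_on c F" "joins F S" using assms(5) by blast
    have "S \<noteq> {}" using S by auto
    then obtain W T where T: "steiner_tree V E S W T" "T \<subseteq> F"
      using steiner_tree_exists[OF assms(1)] F assms(2) S by (metis subset_trans)
    have "inj_on h (c ` F)" using h(2) F(1) by (meson image_mono inj_on_subset)
    then have "inj_on (h \<circ> c) F" using F(2) by (rule comp_inj_on[rotated])
    then have "inj_on c' F" using F(1) by (auto simp: c'_def inj_on_def)
    then have "rainbow c' T" unfolding rainbow_def using T(2) inj_on_subset by blast
    then show "\<exists>W F. steiner_tree V E S W F \<and> rainbow c' F" using T(1) by blast
  qed
  then show ?thesis by blast
qed

text \<open>A forest grown from a single vertex joins everything; with \<open>id\<close> each of its
  at most n - 1 edges is its own colour.\<close>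

lemma coloring_order_minus_one:
  assumes "connected_graph V E" "card V \<ge> 3"
  shows "\<exists>c. three_rainbow_coloring V E (card V - 1) c"
proof -
  obtain w where w: "w \<in> V" using connected_graphD(2)[OF assms(1)] by blast
  obtain X where X: "X \<subseteq> E" "card X \<le> card V - 1" "\<forall>v\<in>V. joined X v w"
    using growing_forest[OF assms(1), of "{w}"] w by auto
  show ?thesis
  proof (rule coloring_exists[OF assms(1) X(1), of id])
    show "card (id ` X) \<le> card V - 1" "1 \<le> card V - 1" using X assms(2) by auto
    fix S assume "S \<subseteq> V"
    then show "\<exists>F\<subseteq>X. inj_on id F \<and> joins F S"
      using X(3) by (intro exI[of _ X]) (auto intro: joinsI)
  qed
qed

text \<open>Pigeonhole: after one target is chosen for each member of \<open>S\<close>, some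
  \<open>p\<close> in the larger set \<open>P\<close> is unchosen. \<open>P\<close> collects the
  candidates for omission, \<open>Q\<close> the targets always kept.\<close>

lemma avoid_one_target:
  assumes "finite S" "card S < card P" "\<And>s. s \<in> S \<Longrightarrow> \<exists>p\<in>P \<union> Q. R s p"
  shows "\<exists>p\<in>P. \<forall>s\<in>S. \<exists>p'\<in>P \<union> Q - {p}. R s p'"
proof -
  obtain r where r: "\<And>s. s \<in> S \<Longrightarrow> r s \<in> P \<union> Q \<and> R s (r s)" using assms(3) by metis
  have "\<not> P \<subseteq> r ` S"
    using card_image_le[OF assms(1), of r] card_mono[of "r ` S" P] assms(1,2) by auto
  then obtain p where "p \<in> P" "p \<notin> r ` S" by blast
  then show ?thesis using r by (intro bexI[of _ p]) (auto intro!: bexI[of _ "r _"])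
qed

section \<open>Colourings with two colours fewer than vertices\<close>

text \<open>Contracting \<open>F0\<close> leaves the 4-cycle \<open>v0 v1 v2 v3\<close>. Three vertices of the graph miss the class
  of one \<open>vi\<close>; dropping the two edges at \<open>vi\<close> leaves two consecutive edges, of different colours.\<close>

lemma coloring_square:
  assumes G: "connected_graph V E"
    and F0: "F0 \<subseteq> E" "card F0 + 4 \<le> card V"
    and d: "distinct [v0, v1, v2, v3]" "v4 \<notin> {v1, v2, v3}"
    and ed: "{v0, v1} \<in> E - F0" "{v1, v2} \<in> E - F0" "{v2, v3} \<in> E - F0" "{v3, v4} \<in> E - F0"
    and v4: "joined F0 v4 v0"
    and cov: "\<And>v. v \<in> V \<Longrightarrow> \<exists>w\<in>{v0, v1, v2, v3}. joined F0 v w"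
  shows "\<exists>c. three_rainbow_coloring V E (card V - 2) c"
proof -
  \<comment> \<open>The square closes only up to \<open>F0\<close>: the last edge ends at
    \<open>v4\<close>, which \<open>F0\<close> joins to \<open>v0\<close>. For a 4-cycle the two
    coincide.\<close>
  define e1 e2 e3 e4 where e: "e1 = {v0, v1}" "e2 = {v1, v2}" "e3 = {v2, v3}" "e4 = {v3, v4}"
  have ne: "e1 \<noteq> e2" "e1 \<noteq> e3" "e1 \<noteq> e4" "e2 \<noteq> e3" "e2 \<noteq> e4" "e3 \<noteq> e4"
    using d by (auto simp: e doubleton_eq_iff)
  have nF: "e1 \<notin> F0" "e2 \<notin> F0" "e3 \<notin> F0" "e4 \<notin> F0" using ed by (auto simp: e)
  define c where "c = id(e3 := e1, e4 := e2)"
  define E' where "E' = F0 \<union> {e1, e2, e3, e4}"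
  have fin: "finite F0" using F0(1) connected_graphD(3)[OF G] finite_subset by blast
  show ?thesis
  proof (rule coloring_exists[OF G, of E' c])
    show "E' \<subseteq> E" using F0 ed by (auto simp: E'_def e)
    have "c ` E' \<subseteq> F0 \<union> {e1, e2}" by (auto simp: c_def E'_def)
    then have "card (c ` E') \<le> card (F0 \<union> {e1, e2})" using fin by (intro card_mono) auto
    also have "\<dots> = card F0 + 2" using fin nF ne by simp
    finally show "card (c ` E') \<le> card V - 2" using F0(2) by linarith
    show "1 \<le> card V - 2" using F0(2) by linarith
    fix S assume S: "S \<subseteq> V" "card S = 3"
    let ?P = "{v0, v1, v2, v3}"
    have "card ?P = 4" using d(1) by simp
    then obtain p where p: "p \<in> ?P" "\<forall>s\<in>S. \<exists>w\<in>?P - {p}. joined F0 s w"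
      using avoid_one_target[of S ?P "{}" "joined F0"] cov S card.infinite by fastforce
    \<comment> \<open>Every vertex of \<open>S\<close> reaches a target other than \<open>p\<close>
      within \<open>F0\<close>, so it remains to gather these three targets at one vertex
      \<open>r\<close>.\<close>
    have J: "joins (F0 \<union> F) S" if "\<And>w. w \<in> ?P - {p} \<Longrightarrow> joined (F0 \<union> F) w r" for F r
      using p(2) that by (intro joinsI[of _ _ r]) (metis joined_mono joined_trans sup_ge1)
    have 4: "joined (F0 \<union> F) v4 v0" for F using v4 joined_mono by (metis sup_ge1)
    have sym: "joined F u v" "joined F v u" if "{u, v} \<in> F" for F and u v :: 'a
      using joined_edge[OF that] joined_sym by auto
    consider "p = v0" | "p = v1" | "p = v2" | "p = v3" using p(1) by blast
    then have "\<exists>F\<in>{{e2, e3}, {e3, e4}, {e1, e4}, {e1, e2}}. joins (F0 \<union> F) S"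
    proof cases
      case 1
      let ?F = "F0 \<union> {e2, e3}"
      have "joined ?F v1 v2" "joined ?F v3 v2" by (auto intro!: sym simp: e)
      then have "joins ?F S" using 1 by (intro J[of _ v2]) auto
      then show ?thesis by (rule bexI) simp
    next
      case 2
      let ?F = "F0 \<union> {e3, e4}"
      have "joined ?F v2 v3" "joined ?F v4 v3" by (auto intro!: sym simp: e)
      moreover have "joined ?F v0 v4" by (rule joined_sym[OF 4])
      ultimately have "joins ?F S" using 2 joined_trans[of ?F v0 v4 v3] by (intro J[of _ v3]) auto
      then show ?thesis by (rule bexI) simp
    next
      case 3
      let ?F = "F0 \<union> {e1, e4}"
      have "joined ?F v1 v0" "joined ?F v3 v4" by (auto intro!: sym simp: e)
      then have "joins ?F S" using 3 joined_trans[OF _ 4, of "{e1, e4}" v3] by (intro J[of _ v0]) auto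
      then show ?thesis by (rule bexI) simp
    next
      case 4
      let ?F = "F0 \<union> {e1, e2}"
      have "joined ?F v0 v1" "joined ?F v2 v1" by (auto intro!: sym simp: e)
      then have "joins ?F S" using 4 by (intro J[of _ v1]) auto
      then show ?thesis by (rule bexI) simp
    qed
    then obtain F where F: "F \<in> {{e2, e3}, {e3, e4}, {e1, e4}, {e1, e2}}" "joins (F0 \<union> F) S" by blast
    have "inj_on c (F0 \<union> F)" using F(1) ne nF by (auto simp: inj_on_def c_def)
    moreover have "F0 \<union> F \<subseteq> E'" using F(1) by (auto simp: E'_def)
    ultimately show "\<exists>F\<subseteq>E'. inj_on c F \<and> joins F S" using F(2) by blast
  qed
qed

text \<open>Equal edges at different positions would make each position the successor of the other,
  which modulo a length of at least 3 is impossible.\<close>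

lemma cycle_edges_inj:
  assumes "cycle E p"
  shows "inj_on (\<lambda>i. {p ! i, p ! (Suc i mod length p)}) {..<length p}"
proof (rule inj_onI)
  let ?n = "length p"
  fix i j assume ij: "i \<in> {..<?n}" "j \<in> {..<?n}"
    "{p ! i, p ! (Suc i mod ?n)} = {p ! j, p ! (Suc j mod ?n)}"
  have n: "?n \<ge> 3" and d: "distinct p" using assms by (auto simp: cycle_def)
  have "0 < ?n" using n by linarith
  then have lt: "i < ?n" "j < ?n" "Suc i mod ?n < ?n" "Suc j mod ?n < ?n"
    using ij(1,2) mod_less_divisor by blast+
  have "i = j \<or> i = Suc j mod ?n \<and> j = Suc i mod ?n"
    using ij(3) lt by (auto simp: doubleton_eq_iff nth_eq_iff_index_eq[OF d])
  then show "i = j" using lt n by (auto simp: mod_Suc split: if_splits)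
qed

lemma cycle_in_vertices:
  assumes "connected_graph V E" "cycle E p"
  shows "set p \<subseteq> V"
  using assms connected_graphD(4)[OF assms(1)] by (fastforce simp: cycle_def in_set_conv_nth)

lemma coloring_long_cycle:
  assumes G: "connected_graph V E" and p: "cycle E p" "length p \<ge> 4"
  shows "\<exists>c. three_rainbow_coloring V E (card V - 2) c"
proof -
  let ?k = "length p"
  define f where "f = (\<lambda>i. {p ! i, p ! (Suc i mod ?k)})"
  have d: "distinct p" and fE: "\<And>i. i < ?k \<Longrightarrow> f i \<in> E" using p(1) by (auto simp: cycle_def f_def)
  have inj: "inj_on f {..<?k}" using cycle_edges_inj[OF p(1)] by (simp add: f_def)
  have pV: "set p \<subseteq> V" by (rule cycle_in_vertices[OF G p(1)])
  have fp: "f i \<subseteq> set p" if "i < ?k" for i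
  proof -
    have "Suc i mod ?k < ?k" using that by (intro mod_less_divisor) linarith
    then show ?thesis using that by (simp add: f_def)
  qed
  have ck: "card (set p) = ?k" using d by (rule distinct_card)
  have kV: "?k \<le> card V" using card_mono[OF connected_graphD(1)[OF G] pV] ck by simp
  have "p \<noteq> []" using p(2) by auto
  then have "set p \<noteq> {}" by simp
  then obtain X where X: "X \<subseteq> E" "card X \<le> card V - ?k" "\<forall>e\<in>X. \<not> e \<subseteq> set p"
    "\<forall>v\<in>V. \<exists>w\<in>set p. joined X v w"
    using growing_forest[OF G pV] ck by auto
  \<comment> \<open>All cycle edges except the first four are contracted together with the forest.
    With k the cycle length this makes at most (k - 4) + (n - k) = n - 4 edges, as
    \<open>coloring_square\<close> requires.\<close>
  define F0 where "F0 = f ` {4..<?k} \<union> X"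
  have fF0: "f i \<in> E - F0" if "i < 4" for i
  proof -
    have "i < ?k" using that p(2) by linarith
    moreover have "f i \<notin> f ` {4..<?k}"
      using inj_onD[OF inj, of i] that \<open>i < ?k\<close> by fastforce
    moreover have "f i \<notin> X" using fp X(3) \<open>i < ?k\<close> by blast
    ultimately show ?thesis using fE by (simp add: F0_def)
  qed
  \<comment> \<open>The contracted edges lead from the fifth vertex round to \<open>p ! 0\<close>.
    The reduction modulo \<open>?k\<close> covers a 4-cycle, where the arc is empty and its start
    already is \<open>p ! 0\<close>.\<close>
  have arc: "joined F0 (p ! (4 mod ?k)) (p ! (j mod ?k))" if "4 \<le> j" "j \<le> ?k" for j
    using that
  proof (induction j rule: dec_induct)
    case base show ?case by simp
  next
    case (step j)
    have "f j \<in> F0" using step by (auto simp: F0_def)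
    then have "joined F0 (p ! j) (p ! (Suc j mod ?k))" unfolding f_def by (rule joined_edge)
    then show ?case using step joined_trans by (metis Suc_leD Suc_le_lessD mod_less)
  qed
  have v4: "joined F0 (p ! (4 mod ?k)) (p ! 0)" using arc[of ?k] p(2) by simp
  show ?thesis
  proof (rule coloring_square[OF G, of F0 "p ! 0" "p ! 1" "p ! 2" "p ! 3" "p ! (4 mod ?k)"])
    show "F0 \<subseteq> E" using X(1) fE by (auto simp: F0_def)
    have "card F0 \<le> card (f ` {4..<?k}) + card X" unfolding F0_def by (rule card_Un_le)
    also have "card (f ` {4..<?k}) \<le> ?k - 4" using card_image_le[of "{4..<?k}" f] by simp
    finally show "card F0 + 4 \<le> card V" using X(2) kV p(2) by linarith
    show "distinct [p ! 0, p ! 1, p ! 2, p ! 3]"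
      using p(2) \<open>p \<noteq> []\<close> by (auto simp: nth_eq_iff_index_eq[OF d])
    have "4 mod ?k = 0 \<or> 4 mod ?k = 4 \<and> 4 < ?k" using p(2) by (cases "?k = 4") auto
    then show "p ! (4 mod ?k) \<notin> {p ! 1, p ! 2, p ! 3}"
      using p(2) \<open>p \<noteq> []\<close> by (auto simp: nth_eq_iff_index_eq[OF d])
    have "?k \<noteq> Suc 0" using p(2) by linarith
    have "Suc i mod ?k = Suc i" if "i < 3" for i using that p(2) by simp
    then have "f 0 = {p ! 0, p ! 1}" "f 1 = {p ! 1, p ! 2}" "f 2 = {p ! 2, p ! 3}"
      using \<open>?k \<noteq> Suc 0\<close> by (simp_all add: f_def numeral_2_eq_2 numeral_3_eq_3)
    then show "{p ! 0, p ! 1} \<in> E - F0" "{p ! 1, p ! 2} \<in> E - F0" "{p ! 2, p ! 3} \<in> E - F0"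
      using fF0[of 0] fF0[of 1] fF0[of 2] by simp_all
    show "{p ! 3, p ! (4 mod ?k)} \<in> E - F0" using fF0[of 3] by (simp add: f_def)
    show "joined F0 (p ! (4 mod ?k)) (p ! 0)" by (rule v4)
    fix v assume "v \<in> V"
    then obtain j where j: "j < ?k" "joined X v (p ! j)" using X(4) by (metis in_set_conv_nth)
    have vj: "joined F0 v (p ! j)" using j(2) by (rule joined_mono) (simp add: F0_def)
    show "\<exists>w\<in>{p ! 0, p ! 1, p ! 2, p ! 3}. joined F0 v w"
    proof (cases "j < 4")
      case True
      then have "j = 0 \<or> j = 1 \<or> j = 2 \<or> j = 3" by linarith
      then show ?thesis using vj by auto
    next
      case False
      then have "joined F0 (p ! (4 mod ?k)) (p ! j)" using arc[of j] j(1) by simp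
      then have "joined F0 v (p ! 0)" using vj v4 joined_sym joined_trans by metis
      then show ?thesis by blast
    qed
  qed
qed

text \<open>Contracted edges keep themselves as colours, so for a rainbow set it remains to look at
  the few recoloured edges and to keep their colours off \<open>A\<close>.\<close>

lemma inj_on_fixed_Un:
  assumes "\<And>x. x \<in> A \<Longrightarrow> f x = x" "inj_on f B" "f ` B \<inter> A = {}"
  shows "inj_on f (A \<union> B)"
proof (rule inj_onI)
  fix x y assume "x \<in> A \<union> B" "y \<in> A \<union> B" and eq: "f x = f y"
  then consider "x \<in> A" "y \<in> A" | "x \<in> A" "y \<in> B" | "x \<in> B" "y \<in> A" | "x \<in> B" "y \<in> B" by blast
  then show "x = y"
  proof cases
    case 1 then show ?thesis using assms(1) eq by simp
  next
    case 2 then show ?thesis using assms(1,3) eq by force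
  next
    case 3 then show ?thesis using assms(1,3) eq by force
  next
    case 4 then show ?thesis using assms(2) eq by (simp add: inj_on_def)
  qed
qed

text \<open>Contracting \<open>F0\<close> identifies \<open>x\<close> with \<open>y\<close> and leaves two triangles with this common vertex.
  Three vertices miss the class of one of \<open>a\<close>, \<open>b\<close>, \<open>c\<close>, \<open>d\<close>, and for each choice three edges with
  the three colours connect the other ones to \<open>x\<close>.\<close>

lemma coloring_bowtie:
  assumes G: "connected_graph V E"
    and F0: "F0 \<subseteq> E" "card F0 + 5 \<le> card V"
    and d: "distinct [x, a, b]" "distinct [y, c, d]" "{a, b} \<inter> {y, c, d} = {}" "{c, d} \<inter> {x, a, b} = {}"
    and ed: "{x, a} \<in> E - F0" "{x, b} \<in> E - F0" "{a, b} \<in> E - F0"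
      "{y, c} \<in> E - F0" "{y, d} \<in> E - F0" "{c, d} \<in> E - F0"
    and xy: "joined F0 x y"
    and cov: "\<And>v. v \<in> V \<Longrightarrow> \<exists>w\<in>{a, b, c, d} \<union> {x, y}. joined F0 v w"
  shows "\<exists>c. three_rainbow_coloring V E (card V - 2) c"
proof -
  define e1 e2 e3 f1 f2 f3 where e: "e1 = {x, a}" "e2 = {x, b}" "e3 = {a, b}"
    "f1 = {y, c}" "f2 = {y, d}" "f3 = {c, d}"
  have ne: "distinct [e1, e2, e3, f1, f2, f3]"
    using d by (auto simp: e doubleton_eq_iff)
  have nF: "e1 \<notin> F0" "e2 \<notin> F0" "e3 \<notin> F0" "f1 \<notin> F0" "f2 \<notin> F0" "f3 \<notin> F0" using ed by (auto simp: e)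
  define col where "col = id(f1 := e1, f2 := e2, f3 := e3)"
  define E' where "E' = F0 \<union> {e1, e2, e3, f1, f2, f3}"
  have fin: "finite F0" using F0(1) connected_graphD(3)[OF G] finite_subset by blast
  show ?thesis
  proof (rule coloring_exists[OF G, of E' col])
    show "E' \<subseteq> E" using F0 ed by (auto simp: E'_def e)
    have "col ` E' \<subseteq> F0 \<union> {e1, e2, e3}" by (auto simp: col_def E'_def)
    then have "card (col ` E') \<le> card (F0 \<union> {e1, e2, e3})" using fin by (intro card_mono) auto
    also have "\<dots> = card F0 + 3" using fin nF ne by simp
    finally show "card (col ` E') \<le> card V - 2" using F0(2) by linarith
    show "1 \<le> card V - 2" using F0(2) by linarith
    fix S assume S: "S \<subseteq> V" "card S = 3"
    let ?P = "{a, b, c, d}"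
    have "card ?P = 4" using d by auto
    then obtain p where p: "p \<in> ?P" "\<forall>s\<in>S. \<exists>w\<in>?P \<union> {x, y} - {p}. joined F0 s w"
      using avoid_one_target[of S ?P "{x, y}" "joined F0"] cov S card.infinite by fastforce
    have J: "joins (F0 \<union> F) S" if "\<And>w. w \<in> ?P - {p} \<Longrightarrow> joined (F0 \<union> F) w x" for F
    proof (rule joinsI)
      fix s assume "s \<in> S"
      then obtain w where w: "w \<in> ?P \<union> {x, y} - {p}" "joined F0 s w" using p(2) by blast
      have yx: "joined (F0 \<union> F) y x" using joined_sym[OF xy] by (rule joined_mono) simp
      have sw: "joined (F0 \<union> F) s w" using w(2) by (rule joined_mono) simp
      consider "w = y" | "w = x" | "w \<in> ?P - {p}" using w(1) by blast
      then have "joined (F0 \<union> F) w x"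
      proof cases
        case 1 then show ?thesis using yx by simp
      next
        case 2 then show ?thesis by simp
      qed (rule that)
      with sw show "joined (F0 \<union> F) s x" by (rule joined_trans)
    qed
    have far: "joined (F0 \<union> F) w x" if "{y, w} \<in> F" for F w
    proof -
      have "joined (F0 \<union> F) y w" using that by (intro joined_edge) simp
      moreover have "joined (F0 \<union> F) x y" using joined_mono[OF xy] by blast
      ultimately show ?thesis using joined_sym joined_trans by metis
    qed
    have sym: "joined F u v" "joined F v u" if "{u, v} \<in> F" for F and u v :: 'a
      using joined_edge[OF that] joined_sym by auto
    consider "p = d" | "p = c" | "p = b" | "p = a" using p(1) by blast
    \<comment> \<open>In the triangle without \<open>p\<close>, take the edge opposite the common
      vertex and one edge at it; in the other triangle, the edge from the common vertex to the
      corner that is left. The parallel colouring lets this last edge carry the third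
      colour.\<close>
    then have "\<exists>F\<in>{{e3, e2, f1}, {e3, e1, f2}, {e1, f3, f2}, {e2, f3, f1}}. joins (F0 \<union> F) S"
    proof cases
      case 1
      let ?F = "F0 \<union> {e3, e2, f1}"
      have *: "joined ?F a b" "joined ?F b x" by (auto intro!: sym simp: e)
      have "joined ?F c x" by (rule far) (simp add: e)
      then have "joins ?F S" using 1 * joined_trans[OF *] by (intro J) auto
      then show ?thesis by (rule bexI) simp
    next
      case 2
      let ?F = "F0 \<union> {e3, e1, f2}"
      have *: "joined ?F b a" "joined ?F a x" by (auto intro!: sym simp: e)
      have "joined ?F d x" by (rule far) (simp add: e)
      then have "joins ?F S" using 2 * joined_trans[OF *] by (intro J) auto
      then show ?thesis by (rule bexI) simp
    next
      case 3
      let ?F = "F0 \<union> {e1, f3, f2}"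
      have *: "joined ?F c d" "joined ?F a x" by (auto intro!: sym simp: e)
      have "joined ?F d x" by (rule far) (simp add: e)
      then have "joins ?F S" using 3 * joined_trans[OF *(1)] by (intro J) auto
      then show ?thesis by (rule bexI) simp
    next
      case 4
      let ?F = "F0 \<union> {e2, f3, f1}"
      have *: "joined ?F d c" "joined ?F b x" by (auto intro!: sym simp: e)
      have "joined ?F c x" by (rule far) (simp add: e)
      then have "joins ?F S" using 4 * joined_trans[OF *(1)] by (intro J) auto
      then show ?thesis by (rule bexI) simp
    qed
    then obtain F where F: "F \<in> {{e3, e2, f1}, {e3, e1, f2}, {e1, f3, f2}, {e2, f3, f1}}"
      "joins (F0 \<union> F) S" by blast
    have "F0 \<union> F \<subseteq> E'" using F(1) by (auto simp: E'_def)
    moreover have "inj_on col (F0 \<union> F)"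
    proof (rule inj_on_fixed_Un)
      show "\<And>g. g \<in> F0 \<Longrightarrow> col g = g" using nF by (auto simp: col_def)
      have three: "inj_on col {u, v, w} \<and> col ` {u, v, w} \<inter> F0 = {}"
        if "distinct [col u, col v, col w]" "{col u, col v, col w} \<subseteq> {e1, e2, e3}" for u v w
      proof
        show "inj_on col {u, v, w}" using that(1) by (auto simp: inj_on_def)
        have "col ` {u, v, w} \<subseteq> {e1, e2, e3}" using that(2) by (simp only: image_insert image_empty)
        moreover have "{e1, e2, e3} \<inter> F0 = {}" using nF by simp
        ultimately show "col ` {u, v, w} \<inter> F0 = {}" by blast
      qed
      have col: "col e1 = e1" "col e2 = e2" "col e3 = e3" "col f1 = e1" "col f2 = e2" "col f3 = e3"
        using ne by (simp_all add: col_def)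
      have ne': "distinct [e1, e2, e3]" "e2 \<noteq> e1" "e3 \<noteq> e1" "e3 \<noteq> e2" using ne by auto
      have "inj_on col {e3, e2, f1} \<and> col ` {e3, e2, f1} \<inter> F0 = {}"
        "inj_on col {e3, e1, f2} \<and> col ` {e3, e1, f2} \<inter> F0 = {}"
        "inj_on col {e1, f3, f2} \<and> col ` {e1, f3, f2} \<inter> F0 = {}"
        "inj_on col {e2, f3, f1} \<and> col ` {e2, f3, f1} \<inter> F0 = {}"
        by (rule three; use ne' in \<open>simp add: col\<close>)+
      then show "inj_on col F" "col ` F \<inter> F0 = {}"
        using F(1) unfolding insert_iff empty_iff by metis+
    qed
    ultimately have "F0 \<union> F \<subseteq> E'" "inj_on col (F0 \<union> F)" by simp_all
    then show "\<exists>F\<subseteq>E'. inj_on col F \<and> joins F S" using F(2) \<open>F0 \<union> F \<subseteq> E'\<close> by blast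
  qed
qed

section \<open>Triangles as vertex sets, and graphs with two of them\<close>

definition triangle :: "'a set set \<Rightarrow> 'a set \<Rightarrow> bool" where
  "triangle E T \<longleftrightarrow> card T = 3 \<and> (\<forall>u\<in>T. \<forall>v\<in>T. u \<noteq> v \<longrightarrow> {u, v} \<in> E)"

lemma triangleI:
  assumes "distinct [x, y, z]" "{x, y} \<in> E" "{y, z} \<in> E" "{x, z} \<in> E"
  shows "triangle E {x, y, z}"
  using assms by (auto simp: triangle_def insert_commute)

lemma triangle_labels:
  assumes "triangle E T" "x \<in> T"
  obtains a b where "T = {x, a, b}" "distinct [x, a, b]" "{x, a} \<in> E" "{x, b} \<in> E" "{a, b} \<in> E"
proof -
  have "finite T" using assms by (auto simp: triangle_def intro: card_ge_0_finite)
  then have "card (T - {x}) = 2" using assms by (simp add: triangle_def)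
  then obtain a b where "T - {x} = {a, b}" "a \<noteq> b" by (auto simp: card_2_iff)
  then have "T = {x, a, b}" "distinct [x, a, b]" using assms(2) by auto
  then show ?thesis using assms that[of a b] by (auto simp: triangle_def)
qed

lemma triangle_in_vertices:
  assumes "connected_graph V E" "triangle E T"
  shows "T \<subseteq> V"
proof
  fix x assume "x \<in> T"
  then obtain a b where "{x, a} \<in> E" using triangle_labels[OF assms(2)] by metis
  then show "x \<in> V" using connected_graphD(4)[OF assms(1)] by blast
qed

lemma cycle_3_triangle:
  assumes "cycle E p" "length p = 3"
  shows "triangle E (set p)"
proof -
  obtain x y z where p: "p = [x, y, z]"
    using assms(2) by (auto simp: numeral_3_eq_3 length_Suc_conv)
  have ed: "{p ! i, p ! (Suc i mod 3)} \<in> E" if "i < 3" for i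
    using assms that by (auto simp: cycle_def)
  have "{x, y} \<in> E" "{y, z} \<in> E" "{z, x} \<in> E"
    using ed[of 0] ed[of 1] ed[of 2] unfolding p by (simp_all add: numeral_2_eq_2)
  then show ?thesis using assms(1) triangleI[of x y z E] by (simp add: p cycle_def insert_commute)
qed

text \<open>Without the common edge \<open>{x, y}\<close>, the two third corners \<open>r\<close>
  and \<open>s\<close> give the 4-cycle x, r, y, s.\<close>

lemma triangles_shared_edge_cycle:
  assumes "triangle E T" "triangle E T'" "T \<noteq> T'" "x \<in> T \<inter> T'" "y \<in> T \<inter> T'" "x \<noteq> y"
  shows "\<exists>p. cycle E p \<and> length p = 4"
proof -
  have third: "\<exists>r. U = {x, y, r} \<and> distinct [x, y, r] \<and> {x, r} \<in> E \<and> {r, y} \<in> E"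
    if U: "triangle E U" "x \<in> U" "y \<in> U" for U
  proof -
    obtain a b where ab: "U = {x, a, b}" "distinct [x, a, b]" "{x, a} \<in> E" "{x, b} \<in> E" "{a, b} \<in> E"
      using triangle_labels[OF U(1,2)] by metis
    then have "y = a \<or> y = b" using U(3) assms(6) by auto
    then show ?thesis
    proof
      assume "y = a" then show ?thesis using ab by (intro exI[of _ b]) (auto simp: insert_commute)
    next
      assume "y = b" then show ?thesis using ab by (intro exI[of _ a]) (auto simp: insert_commute)
    qed
  qed
  obtain r where r: "T = {x, y, r}" "distinct [x, y, r]" "{x, r} \<in> E" "{r, y} \<in> E"
    using third[OF assms(1)] assms(4,5) by auto
  obtain s where s: "T' = {x, y, s}" "distinct [x, y, s]" "{x, s} \<in> E" "{s, y} \<in> E"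
    using third[OF assms(2)] assms(4,5) by auto
  have rs: "r \<noteq> s" using r(1) s(1) assms(3) by auto
  have "cycle E [x, r, y, s]"
    using r(2-4) s(2-4) rs unfolding cycle_def by (auto simp: less_Suc_eq insert_commute)
  then show ?thesis by (intro exI[of _ "[x, r, y, s]"]) simp
qed

text \<open>Two common vertices give a 4-cycle. With one, the forest has at most n - 5 edges and the
  bowtie applies at once. Disjoint triangles leave at most n - 6 edges, hence room for one more edge
  if the forest does not already link them.\<close>

lemma coloring_two_triangles:
  assumes G: "connected_graph V E" and T: "triangle E T" "triangle E T'" "T \<noteq> T'"
  shows "\<exists>c. three_rainbow_coloring V E (card V - 2) c"
proof -
  have TV: "T \<union> T' \<subseteq> V" using triangle_in_vertices[OF G] T by blast
  have c3: "card T = 3" "card T' = 3" "finite T" "finite T'"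
    using T by (auto simp: triangle_def intro: card_ge_0_finite)
  have cV: "card (T \<union> T') \<le> card V" using TV connected_graphD(1)[OF G] by (intro card_mono)
  have ne: "T \<union> T' \<noteq> {}" using c3 by auto
  obtain X where X: "X \<subseteq> E" "card X \<le> card V - card (T \<union> T')"
    "\<forall>e\<in>X. \<not> e \<subseteq> T \<union> T'" "\<forall>v\<in>V. \<exists>w\<in>T \<union> T'. joined X v w"
    using growing_forest[OF G TV ne] by blast
  \<comment> \<open>\<open>T \<inter> T' \<subseteq> {x} \<inter> {y}\<close> covers both
    situations: disjoint triangles, or \<open>x = y\<close> as the only common vertex.\<close>
  have bowtie: ?thesis if F0: "F0 \<subseteq> E" "card F0 + 5 \<le> card V" "X \<subseteq> F0"
    "\<And>e. e \<in> F0 \<Longrightarrow> \<not> e \<subseteq> T" "\<And>e. e \<in> F0 \<Longrightarrow> \<not> e \<subseteq> T'"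
    and xy: "x \<in> T" "y \<in> T'" "joined F0 x y" "T \<inter> T' \<subseteq> {x} \<inter> {y}" for F0 x y
  proof -
    obtain a b where ab: "T = {x, a, b}" "distinct [x, a, b]" "{x, a} \<in> E" "{x, b} \<in> E" "{a, b} \<in> E"
      using triangle_labels[OF T(1) xy(1)] by metis
    obtain c d where cd: "T' = {y, c, d}" "distinct [y, c, d]" "{y, c} \<in> E" "{y, d} \<in> E" "{c, d} \<in> E"
      using triangle_labels[OF T(2) xy(2)] by metis
    show ?thesis
    proof (rule coloring_bowtie[OF G F0(1,2) ab(2) cd(2) _ _ _ _ _ _ _ _ xy(3)])
      show "{a, b} \<inter> {y, c, d} = {}" "{c, d} \<inter> {x, a, b} = {}"
        using xy(4) ab(1,2) cd(1,2) by auto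
      show "{x, a} \<in> E - F0" "{x, b} \<in> E - F0" "{a, b} \<in> E - F0"
        using ab F0(4)[of "{x, a}"] F0(4)[of "{x, b}"] F0(4)[of "{a, b}"] by auto
      show "{y, c} \<in> E - F0" "{y, d} \<in> E - F0" "{c, d} \<in> E - F0"
        using cd F0(5)[of "{y, c}"] F0(5)[of "{y, d}"] F0(5)[of "{c, d}"] by auto
      fix v assume "v \<in> V"
      then obtain w where "w \<in> T \<union> T'" "joined X v w" using X(4) by blast
      then have "w \<in> {a, b, c, d} \<union> {x, y}" "joined F0 v w"
        using joined_mono[OF _ F0(3)] by (auto simp: ab(1) cd(1))
      then show "\<exists>w\<in>{a, b, c, d} \<union> {x, y}. joined F0 v w" by blast
    qed
  qed
  show ?thesis
  proof (cases "\<exists>u v. u \<in> T \<inter> T' \<and> v \<in> T \<inter> T' \<and> u \<noteq> v")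
    case True
    then obtain p where "cycle E p" "length p = 4"
      using triangles_shared_edge_cycle[OF T] by metis
    then show ?thesis using coloring_long_cycle[OF G] by simp
  next
    case single: False
    show ?thesis
    proof (cases "T \<inter> T' = {}")
      case False
      then obtain x where x: "T \<inter> T' = {x}" using single by blast
      have "card (T \<union> T') = 5" using card_Un_Int[OF c3(3,4)] x c3(1,2) by simp
      then have "card X + 5 \<le> card V" using X(2) cV by linarith
      then show ?thesis using X(3) x by (intro bowtie[OF X(1), of x x]) auto
    next
      case True
      then have c6: "card (T \<union> T') = 6" using card_Un_disjoint[OF c3(3,4)] c3(1,2) by simp
      have "T \<noteq> {}" "T' \<noteq> {}" using c3 by auto
      then obtain t t' where t: "t \<in> T" "t' \<in> T'" by blast
      show ?thesis
      proof (cases "\<exists>y\<in>T'. \<exists>x\<in>T. joined X y x")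
        case True
        then obtain y x where x: "y \<in> T'" "x \<in> T" "joined X y x" by blast
        have "card X + 5 \<le> card V" using X(2) cV c6 by linarith
        then show ?thesis using X(3) \<open>T \<inter> T' = {}\<close> x(1,2) joined_sym[OF x(3)]
          by (intro bowtie[OF X(1), of x y]) auto
      next
        case apart: False
        \<comment> \<open>An edge leaving the vertices attached to \<open>T\<close> ends at a vertex
          attached to \<open>T'\<close>, since every vertex is attached to one of them. It lies in
          neither triangle: \<open>v\<close> is not attached to \<open>T\<close>, and
          \<open>u\<close>, being attached to \<open>T\<close>, is not in \<open>T'\<close>.\<close>
        then obtain u v where uv: "{u, v} \<in> E" "\<exists>x\<in>T. joined X u x" "\<not> (\<exists>x\<in>T. joined X v x)"
          using connected_leaving_edge[OF G, of t "\<lambda>v. \<exists>x\<in>T. joined X v x" t'] t TV joined_refl[of X t] by blast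
        obtain x where x: "x \<in> T" "joined X u x" using uv(2) by blast
        have "v \<in> V" using uv(1) connected_graphD(4)[OF G] by blast
        then obtain y where y: "y \<in> T'" "joined X v y" using X(4) uv(3) by blast
        let ?F = "insert {u, v} X"
        have "finite X" using X(1) connected_graphD(3)[OF G] finite_subset by blast
        then have "card ?F \<le> Suc (card X)" by (simp add: card_insert_if)
        then have "card ?F + 5 \<le> card V" using X(2) cV c6 by linarith
        moreover have "joined ?F x y"
        proof -
          have "joined ?F u x" "joined ?F v y" using x y joined_mono by (metis subset_insertI)+
          moreover have "joined ?F u v" by (rule joined_edge) simp
          ultimately show ?thesis using joined_sym joined_trans by metis
        qed
        moreover have "\<not> {u, v} \<subseteq> T" using uv(3) joined_refl[of X v] by blast
        moreover have "\<not> {u, v} \<subseteq> T'" using apart uv(2) by blast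
        ultimately show ?thesis using X(1,3) \<open>T \<inter> T' = {}\<close> x(1) y(1) uv(1)
          by (intro bowtie[of ?F x y]) auto
      qed
    qed
  qed
qed

section \<open>Lower bounds\<close>

definition bridge :: "'a set set \<Rightarrow> 'a set \<Rightarrow> bool" where
  "bridge E e \<longleftrightarrow> e \<in> E \<and> (\<forall>a b. e = {a, b} \<longrightarrow> \<not> joined (E - {e}) a b)"

text \<open>The three vertices may coincide: a smaller set is first enlarged to three
  elements.\<close>

lemma coloring_joins:
  assumes "connected_graph V E" "card V \<ge> 3" "three_rainbow_coloring V E q c"
    and S: "{u, v, w} \<subseteq> V"
  obtains F where "F \<subseteq> E" "inj_on c F" "joins F {u, v, w}"
proof -
  let ?S = "{u, v, w}"
  have "card ?S \<le> 3" by (simp add: card_insert_if)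
  then  obtain S' where S': "?S \<subseteq> S'" "S' \<subseteq> V" "card S' = 3"
    using exists_subset_between[OF _ assms(2) S] connected_graphD(1)[OF assms(1)] by blast
  then obtain W F where F: "steiner_tree V E S' W F" "rainbow c F"
    using assms(3) unfolding three_rainbow_coloring_def by blast
  then have "joins F ?S" using S'(1) steiner_tree_joins(2)[OF F(1)] by (auto simp: joins_def)
  then show ?thesis using that F steiner_tree_joins(1)[OF F(1)] by (simp add: rainbow_def)
qed

lemma joins_contains:
  assumes "F \<subseteq> E" "joins F S" "u \<in> S" "v \<in> S" "\<not> joined (E - {e}) u v"
  shows "e \<in> F"
proof (rule ccontr)
  assume "e \<notin> F"
  then have "F \<subseteq> E - {e}" using assms(1) by blast
  moreover have "joined F u v" using assms(2-4) by (auto simp: joins_def)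
  ultimately show False using joined_mono assms(5) by metis
qed

lemma bridges_differ:
  assumes G: "connected_graph V E" "card V \<ge> 3" "three_rainbow_coloring V E q c"
    and ef: "bridge E e" "bridge E f" "e \<noteq> f"
  shows "c e \<noteq> c f"
proof -
  have E: "e \<in> E" "f \<in> E" using ef by (auto simp: bridge_def)
  let ?K = "E - {e, f}"
  obtain a0 b0 where e0: "e = {a0, b0}" "a0 \<in> V" using connected_edgeE[OF G(1) E(1)] by metis
  obtain c0 d0 where f0: "f = {c0, d0}" "c0 \<in> V" using connected_edgeE[OF G(1) E(2)] by metis
  \<comment> \<open>Peeling off \<open>e\<close> and then \<open>f\<close> from a connection between
    the bridges yields their near ends \<open>b\<close> and \<open>c'\<close>, joined without either
    bridge; \<open>a\<close> and \<open>d\<close> become the far ends.\<close>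
  have "insert {a0, b0} (insert f ?K) = E" using E e0 by auto
  then have "joined (insert {a0, b0} (insert f ?K)) a0 c0"
    using connected_graphD(6)[OF G(1) e0(2) f0(2)] by simp
  then obtain b where b: "b \<in> {a0, b0}" "joined (insert f ?K) b c0"
    using joined_insertD[of a0 b0 "insert f ?K" a0 c0] by auto
  then obtain c' where c': "c' \<in> {c0, d0}" "joined ?K b c'"
    using joined_insertD[of c0 d0 ?K b c0] f0(1) by auto
  obtain a where a: "e = {a, b}" using b(1) e0(1) by auto
  obtain d where d: "f = {c', d}" using c'(1) f0(1) by auto
  have V: "a \<in> V" "d \<in> V" using connected_graphD(4)[OF G(1)] E a d by auto
  \<comment> \<open>Otherwise the way from \<open>a\<close> to \<open>d\<close>, back over
    \<open>f\<close> and on to \<open>b\<close> would bypass \<open>e\<close>; the same holds for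
    \<open>f\<close> by symmetry.\<close>
  have "\<not> joined (E - {e}) a d"
  proof
    assume "joined (E - {e}) a d"
    moreover have "joined (E - {e}) d c'" using E(2) ef(3) d by (intro joined_edge) (auto simp: insert_commute)
    moreover have "joined (E - {e}) c' b" using joined_sym[OF c'(2)] by (rule joined_mono) auto
    ultimately have "joined (E - {e}) a b" using joined_trans by metis
    then show False using ef(1) a by (auto simp: bridge_def)
  qed
  moreover have "\<not> joined (E - {f}) a d"
  proof
    assume "joined (E - {f}) a d"
    moreover have "joined (E - {f}) b a" using E(1) ef(3) a by (intro joined_edge) (auto simp: insert_commute)
    moreover have "joined (E - {f}) c' b" using joined_sym[OF c'(2)] by (rule joined_mono) auto
    ultimately have "joined (E - {f}) c' d" using joined_trans by metis
    then show False using ef(2) d by (auto simp: bridge_def)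
  qed
  moreover obtain F where F: "F \<subseteq> E" "inj_on c F" "joins F {a, d}"
    using coloring_joins[OF G, of a d d] V by auto
  ultimately have "e \<in> F" "f \<in> F" using joins_contains[OF F(1,3)] by auto
  then show ?thesis using F(2) ef(3) by (auto simp: inj_on_def)
qed

lemma colors_le:
  assumes "three_rainbow_coloring V E q c" "A \<subseteq> c ` E"
  shows "card A \<le> q"
proof -
  have "A \<subseteq> {1..q}" using assms by (auto simp: three_rainbow_coloring_def)
  then show ?thesis using card_mono[of "{1..q}" A] by simp
qed

section \<open>The lower bound for trees and for unicyclic graphs with a triangle\<close>

lemma tree_bridge:
  assumes "tree V E" "e \<in> E"
  shows "bridge E e"
  unfolding bridge_def
proof (intro conjI allI impI notI)
  fix a b assume ab: "e = {a, b}" "joined (E - {e}) a b"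
  have "a \<noteq> b" using connected_graphD(5)[of V E e] assms ab(1) by (auto simp: tree_def)
  then have "\<exists>p. cycle (insert {a, b} (E - {e})) p"
    using path_closes_to_cycle[OF ab(2)] ab(1) by blast
  moreover have "insert {a, b} (E - {e}) = E" using assms(2) ab(1) by auto
  ultimately show False using assms(1) by (auto simp: tree_def)
qed (rule assms(2))

lemma tree_colors:
  assumes "tree V E" "card V \<ge> 3" "three_rainbow_coloring V E q c"
  shows "card V - 1 \<le> q"
proof -
  have G: "connected_graph V E" using assms(1) by (simp add: tree_def)
  have "inj_on c E"
    using bridges_differ[OF G assms(2,3)] tree_bridge[OF assms(1)] by (meson inj_onI)
  then have "card (c ` E) = card E" by (rule card_image)
  then show ?thesis using colors_le[OF assms(3), of "c ` E"] connected_card_edges[OF G] by simp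
qed

text \<open>The n - 3 edges off the triangle are bridges and have different colours, so it remains
  to show that the triangle contributes two further colours.\<close>

lemma unicyclic_triangle_colors:
  assumes G: "connected_graph V E" "card V \<ge> 3" "three_rainbow_coloring V E q c"
    and U: "card E = card V" and T: "triangle E T"
  shows "card V - 1 \<le> q"
proof -
  note D = connected_graphD[OF G(1)]
  have TV: "T \<subseteq> V" by (rule triangle_in_vertices[OF G(1) T])
  have "T \<noteq> {}" using T by (auto simp: triangle_def)
  then obtain x where "x \<in> T" by blast
  then obtain y z where T': "T = {x, y, z}" "distinct [x, y, z]" "{x, y} \<in> E" "{x, z} \<in> E" "{y, z} \<in> E"
    using triangle_labels[OF T] by metis
  define C where "C = {{x, y}, {x, z}, {y, z}}"
  have CE: "C \<subseteq> E" using T' by (auto simp: C_def)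
  have cC: "card C = 3" using T'(2) by (auto simp: C_def doubleton_eq_iff card_insert_if)
  have CT: "g \<subseteq> T" if "g \<in> C" for g using that by (auto simp: C_def T'(1))

  \<comment> \<open>If \<open>r\<close> still reached all of \<open>T\<close>, both deleted edges
    could be bypassed through \<open>r\<close>, and n - 2 edges would connect n vertices.\<close>
  have cut: "\<exists>s\<in>T. \<not> joined (E - {g, h}) r s" if gh: "g \<in> C" "h \<in> C" "g \<noteq> h" and r: "r \<in> V" for g h r
  proof (rule ccontr)
    assume "\<not> ?thesis"
    then have rs: "joined (E - {g, h}) r s" if "s \<in> T" for s using that by blast
    have "connected_graph V (E - {g, h})"
    proof (rule connected_graphI[OF G(1)])
      fix u v assume "u \<in> V" "v \<in> V"
      show "joined (E - {g, h}) u v"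
      proof (rule joined_bind[OF D(6)[OF \<open>u \<in> V\<close> \<open>v \<in> V\<close>]])
        fix u' v' assume e: "{u', v'} \<in> E"
        show "joined (E - {g, h}) u' v'"
        proof (cases "{u', v'} \<in> {g, h}")
          case True
          then have "u' \<in> T" "v' \<in> T" using CT gh by blast+
          then show ?thesis using rs joined_sym joined_trans by metis
        qed (use e in \<open>auto intro: joined_edge\<close>)
      qed
    qed auto
    then have "card V \<le> card (E - {g, h}) + 1" by (rule connected_card_edges)
    moreover have "card (E - {g, h}) = card E - 2"
      using gh CE by (subst card_Diff_subset) auto
    ultimately show False using U G(2) by linarith
  qed

  \<comment> \<open>If \<open>e\<close> could be bypassed, \<open>{x, y}\<close> could then be
    deleted as well, by the detour through \<open>z\<close>, again leaving too few edges.\<close>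
  have br: "bridge E e" if e: "e \<in> E - C" for e
    unfolding bridge_def
  proof (intro conjI allI impI notI)
    fix a b assume ab: "e = {a, b}" "joined (E - {e}) a b"
    have con: "joined (E - {e}) u v" if "u \<in> V" "v \<in> V" for u v
      using joined_remove[OF D(6)[OF that]] ab by simp
    have xy: "joined (E - {e} - {{x, y}}) x y"
    proof -
      have "{x, z} \<in> E - {e} - {{x, y}}" "{z, y} \<in> E - {e} - {{x, y}}"
        using T'(2,4,5) e by (simp_all add: C_def doubleton_eq_iff insert_commute[of z y]) auto
      then show ?thesis by (rule joined_trans[OF joined_edge joined_edge])
    qed
    have "connected_graph V (E - {e} - {{x, y}})"
      by (rule connected_graphI[OF G(1)]) (blast, rule joined_remove[OF con xy])
    then have "card V \<le> card (E - {e} - {{x, y}}) + 1" by (rule connected_card_edges)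
    moreover have "{x, y} \<in> E - {e}" "e \<in> E" using e T'(3) by (auto simp: C_def)
    then have "card (E - {e} - {{x, y}}) = card E - 2" by simp
    ultimately show False using U G(2) by linarith
  qed (use that in auto)

  \<comment> \<open>The triangle stays together without the bridge \<open>e\<close>, so some vertex
    \<open>r\<close> is cut off from all of it; a tree containing \<open>r\<close> and a corner must
    use \<open>e\<close>.\<close>
  have far: "\<exists>r\<in>V. \<forall>s\<in>T. \<not> joined (E - {e}) r s" if e: "e \<in> E - C" for e
  proof (rule ccontr)
    assume no: "\<not> ?thesis"
    have "e \<in> E" using e by blast
    then obtain a b where ab: "e = {a, b}" "a \<in> V" "b \<in> V" using connected_edgeE[OF G(1)] by metis
    have sx: "joined (E - {e}) s x" if "s \<in> T" for s
    proof (cases "s = x")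
      case False
      then have "{s, x} \<in> C" using that by (auto simp: T'(1) C_def insert_commute)
      then show ?thesis using CE e by (intro joined_edge) auto
    qed simp
    have to_x: "joined (E - {e}) r x" if "r \<in> V" for r
    proof -
      obtain s where s: "s \<in> T" "joined (E - {e}) r s" using no \<open>r \<in> V\<close> by blast
      show ?thesis by (rule joined_trans[OF s(2) sx[OF s(1)]])
    qed
    have "joined (E - {e}) a b" by (rule joined_trans[OF to_x[OF ab(2)] joined_sym[OF to_x[OF ab(3)]]])
    then show False using br[OF e] ab(1) by (auto simp: bridge_def)
  qed

  let ?N = "c ` (E - C)"
  have "inj_on c (E - C)" using bridges_differ[OF G] br by (meson inj_onI)
  then have cN: "card ?N = card V - 3"
    using U card_Diff_subset[OF _ CE] cC by (simp add: card_image C_def)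
  have fN: "finite ?N" using D(3) by simp
  show ?thesis
  proof (rule ccontr)
    assume small: "\<not> ?thesis"
    \<comment> \<open>Two different new colours on the triangle, added to the n - 3 bridge colours,
      would already make n - 1.\<close>
    have clash: "c g = c h \<or> c g \<in> ?N \<or> c h \<in> ?N" if "g \<in> C" "h \<in> C" for g h
    proof (rule ccontr)
      assume "\<not> ?thesis"
      then have "card (insert (c g) (insert (c h) ?N)) = card V - 1" using fN cN G(2) by simp
      moreover have "insert (c g) (insert (c h) ?N) \<subseteq> c ` E" using that CE by auto
      ultimately show False using colors_le[OF G(3)] small by metis
    qed
    have no_tree: False if "F \<subseteq> E - {g, h}" "joins F S" "r \<in> S" "s \<in> S" "\<not> joined (E - {g, h}) r s"
      for F S r s g h
      using that joined_mono by (metis joins_def)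
    have diff: "g \<notin> F" if "inj_on c F" "e \<in> F" "c g = c e" "e \<in> E - C" "g \<in> C" for F e g
      using that by (auto simp: inj_on_def)
    consider (two) g h where "g \<in> C" "h \<in> C" "g \<noteq> h" "c g \<in> ?N" "c h \<in> ?N"
      | (one) g h k where "g \<in> C" "h \<in> C" "k \<in> C" "distinct [g, h, k]" "c g \<in> ?N" "c h = c k"
      | (none) "\<And>g h. g \<in> C \<Longrightarrow> h \<in> C \<Longrightarrow> c g = c h"
    proof (cases "\<exists>g\<in>C. c g \<in> ?N")
      case True
      then obtain g where g: "g \<in> C" "c g \<in> ?N" by blast
      have "card (C - {g}) = 2" using g(1) cC by (simp add: C_def)
      then obtain h k where hk: "C - {g} = {h, k}" "h \<noteq> k" by (auto simp: card_2_iff)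
      then have "h \<in> C" "k \<in> C" "distinct [g, h, k]" by auto
      then show ?thesis using g clash[of h k] two[of g h] two[of g k] one[of g h k] by auto
    next
      case False
      then show ?thesis using clash none by blast
    qed
    then show False
    proof cases
      case two
      \<comment> \<open>The vertices \<open>r\<close> and \<open>r'\<close> force \<open>e\<close>
        and \<open>f\<close> into the tree. Their colours exclude \<open>g\<close> and
        \<open>h\<close>, without which \<open>r\<close> cannot reach \<open>s\<close>.\<close>
      then obtain e f where ef: "e \<in> E - C" "f \<in> E - C" "c g = c e" "c h = c f" by blast
      obtain r where r: "r \<in> V" "\<And>s. s \<in> T \<Longrightarrow> \<not> joined (E - {e}) r s" using far[OF ef(1)] by blast
      obtain r' where r': "r' \<in> V" "\<And>s. s \<in> T \<Longrightarrow> \<not> joined (E - {f}) r' s" using far[OF ef(2)] by blast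
      obtain s where s: "s \<in> T" "\<not> joined (E - {g, h}) r s" using cut[OF two(1-3) r(1)] by blast
      obtain F where F: "F \<subseteq> E" "inj_on c F" "joins F {r, r', s}"
        using coloring_joins[OF G, of r r' s] r(1) r'(1) s(1) TV by blast
      have "e \<in> F" "f \<in> F"
        using joins_contains[OF F(1,3)] r(2)[OF s(1)] r'(2)[OF s(1)] by blast+
      then have "F \<subseteq> E - {g, h}" using diff[OF F(2)] ef two F(1) by blast
      then show False using no_tree[OF _ F(3), of g h r s] s(2) by simp
    next
      case one
      \<comment> \<open>The vertex \<open>r\<close> forces \<open>e\<close>, which excludes
        \<open>g\<close>; since \<open>h\<close> and \<open>k\<close> share a colour, one of them is
        missing too. The corners \<open>s\<close> and \<open>s'\<close> are chosen against the two
        possibilities.\<close>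
      then obtain e where e: "e \<in> E - C" "c g = c e" by blast
      obtain r where r: "r \<in> V" "\<And>s. s \<in> T \<Longrightarrow> \<not> joined (E - {e}) r s" using far[OF e(1)] by blast
      obtain s where s: "s \<in> T" "\<not> joined (E - {g, h}) r s" using cut[of g h r] one r(1) by auto
      obtain s' where s': "s' \<in> T" "\<not> joined (E - {g, k}) r s'" using cut[of g k r] one r(1) by auto
      obtain F where F: "F \<subseteq> E" "inj_on c F" "joins F {r, s, s'}"
        using coloring_joins[OF G, of r s s'] r(1) s(1) s'(1) TV by blast
      have "e \<in> F" using joins_contains[OF F(1,3)] r(2)[OF s(1)] by blast
      then have "g \<notin> F" using diff[OF F(2)] e one(1) by blast
      moreover have "h \<notin> F \<or> k \<notin> F" using F(2) one(4,6) by (auto simp: inj_on_def)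
      ultimately have "F \<subseteq> E - {g, h} \<or> F \<subseteq> E - {g, k}" using F(1) by blast
      then show False
        using no_tree[OF _ F(3), of g h r s] no_tree[OF _ F(3), of g k r s'] s(2) s'(2) by auto
    next
      case none
      \<comment> \<open>A rainbow set contains at most one edge of a monochromatic triangle, but
        joining all three corners would need two.\<close>
      obtain F where F: "F \<subseteq> E" "inj_on c F" "joins F T"
        using coloring_joins[OF G, of x y z] TV unfolding T'(1) by blast
      have "\<exists>g h. g \<in> C \<and> h \<in> C \<and> g \<noteq> h \<and> g \<notin> F \<and> h \<notin> F"
      proof -
        have "inj_on c (C \<inter> F)" using F(2) by (auto intro: inj_on_subset)
        then have "\<forall>g\<in>C \<inter> F. \<forall>h\<in>C \<inter> F. g = h"
          using none by (meson IntD1 inj_onD)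
        moreover have "finite (C \<inter> F)" by (simp add: C_def)
        ultimately have "card (C \<inter> F) \<le> 1" using card_le_Suc0_iff_eq by auto
        then have "2 \<le> card (C - F)" using cC card_Diff_subset_Int[of C F] by (simp add: C_def)
        then obtain g h where "{g, h} \<subseteq> C - F" "g \<noteq> h"
          by (metis card_2_iff obtain_subset_with_card_n)
        then show ?thesis by blast
      qed
      then obtain g h where gh: "g \<in> C" "h \<in> C" "g \<noteq> h" "F \<subseteq> E - {g, h}" using F(1) by blast
      have xV: "x \<in> V" "x \<in> T" using TV T'(1) by auto
      then obtain s where "s \<in> T" "\<not> joined (E - {g, h}) x s" using cut[OF gh(1-3)] by blast
      then show False using no_tree[OF gh(4) F(3) xV(2)] by blast
    qed
  qed
qed

section \<open>The characterization\<close>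

text \<open>If every cycle is a triangle and there is one, the girth is 3, so the edge count differs
  from n. It is at least n because of the cycle, hence larger, and a surplus edge yields a second
  triangle.\<close>

lemma coloring_not_extremal:
  assumes G: "connected_graph V E" "card V \<ge> 3"
    and nt: "\<not> tree V E" and nu: "\<not> (unicyclic V E \<and> girth E = 3)"
  shows "\<exists>c. three_rainbow_coloring V E (card V - 2) c"
proof (cases "\<exists>p. cycle E p \<and> length p \<ge> 4")
  case True
  then show ?thesis using coloring_long_cycle[OF G(1)] by blast
next
  case False
  note D = connected_graphD[OF G(1)]
  have len: "length p = 3" if "cycle E p" for p
    using that False by (force simp: cycle_def)
  obtain p where p: "cycle E p" using nt G(1) by (auto simp: tree_def)
  have "girth E = 3"
  proof -
    have "(\<lambda>p. enat (length p)) ` {p. cycle E p} = {3}"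
      using p len by (force simp: numeral_eq_enat)
    then show ?thesis by (simp add: girth_def)
  qed
  then have ne: "card E \<noteq> card V" using nu G(1) by (auto simp: unicyclic_def)
  let ?T = "set p"
  have T: "triangle E ?T" by (rule cycle_3_triangle[OF p len[OF p]])
  have TV: "?T \<subseteq> V" by (rule triangle_in_vertices[OF G(1) T])
  have T3: "card ?T = 3" using T by (simp add: triangle_def)
  then have "?T \<noteq> {}" by auto
  then obtain x where "x \<in> ?T" using ex_in_conv by metis
  then obtain a b where ab: "?T = {x, a, b}" "distinct [x, a, b]" "{x, a} \<in> E" "{x, b} \<in> E" "{a, b} \<in> E"
    using triangle_labels[OF T] by metis
  obtain X where X: "X \<subseteq> E" "card X \<le> card V - 3" "\<forall>v\<in>V. \<exists>w\<in>?T. joined X v w"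
    using growing_forest[OF G(1) TV \<open>?T \<noteq> {}\<close>] T3 by auto
  \<comment> \<open>A connected spanning subgraph with at most n edges that contains the first
    triangle; any edge of \<open>E\<close> outside it closes another cycle.\<close>
  define H where "H = X \<union> {{x, a}, {x, b}, {a, b}}"
  have "card {{x, a}, {x, b}, {a, b}} = 3" using ab(2) by (auto simp: doubleton_eq_iff card_insert_if)
  then have cH: "card H \<le> card V" using card_Un_le[of X "{{x, a}, {x, b}, {a, b}}"] X(2) G(2)
    by (simp add: H_def)
  have HE: "H \<subseteq> E" using X(1) ab by (auto simp: H_def)
  have TH: "{u, v} \<in> H" if "u \<in> ?T" "v \<in> ?T" "u \<noteq> v" for u v
    using that unfolding ab(1) by (auto simp: H_def insert_commute)
  have conH: "joined H u v" if uv: "u \<in> V" "v \<in> V" for u v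
  proof -
    have "joined H v x" if "v \<in> V" for v
    proof -
      obtain w where w: "w \<in> ?T" "joined X v w" using X(3) \<open>v \<in> V\<close> by blast
      have "joined H v w" using w(2) by (rule joined_mono) (auto simp: H_def)
      moreover have "joined H w x"
        using TH[OF w(1) \<open>x \<in> ?T\<close>] by (cases "w = x") (auto intro: joined_edge)
      ultimately show ?thesis by (rule joined_trans)
    qed
    then show ?thesis using uv joined_sym joined_trans by metis
  qed
  have "card V \<le> card E"
  proof -
    let ?e = "{p ! 0, p ! (length p - 1)}"
    have e: "?e \<in> E" "joined (E - {?e}) (p ! 0) (p ! (length p - 1))"
      using cycle_remove_edge[OF p] by auto
    have "connected_graph V (E - {?e})"
      by (rule connected_graphI[OF G(1)]) (use e(2) D(6) in \<open>auto intro: joined_remove\<close>)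
    then have "card V \<le> card (E - {?e}) + 1" by (rule connected_card_edges)
    moreover have "card E > 0" using e(1) D(3) by (auto simp: card_gt_0_iff)
    ultimately show ?thesis using e(1) by simp
  qed
  then have "E \<noteq> H" using cH ne by auto
  then obtain e where e: "e \<in> E" "e \<notin> H" using HE by blast
  obtain u v where uv: "e = {u, v}" "u \<noteq> v" "u \<in> V" "v \<in> V" using connected_edgeE[OF G(1) e(1)] by metis
  have "{u, v} \<notin> H" using e(2) uv(1) by simp
  then obtain p' where p': "cycle (insert {u, v} H) p'" "p' ! 0 = u" "p' ! (length p' - 1) = v"
    using path_closes_to_cycle[OF conH[OF uv(3,4)] uv(2)] by blast
  have "insert {u, v} H \<subseteq> E" using HE e(1) uv(1) by simp
  then have cp': "cycle E p'" using p'(1) unfolding cycle_def by blast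
  have T2: "triangle E (set p')" by (rule cycle_3_triangle[OF cp' len[OF cp']])
  have "u \<in> set p'" "v \<in> set p'" using p'(2,3) len[OF cp'] by (auto intro: nth_mem)
  \<comment> \<open>\<open>H\<close> contains every edge between corners of the first triangle, so
    that triangle cannot contain both \<open>u\<close> and \<open>v\<close>.\<close>
  then have "?T \<noteq> set p'" using TH uv(2) \<open>{u, v} \<notin> H\<close> by metis
  then show ?thesis using coloring_two_triangles[OF G(1) T T2] by blast
qed

theorem theorem3:
  fixes V :: "'a set" and E :: "'a set set"
  assumes "connected_graph V E" and "card V \<ge> 3"
  shows "rx3 V E = card V - 1 \<longleftrightarrow> tree V E \<or> (unicyclic V E \<and> girth E = 3)"
proof
  assume rx: "rx3 V E = card V - 1"
  show "tree V E \<or> (unicyclic V E \<and> girth E = 3)"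
  proof (rule ccontr)
    assume "\<not> ?thesis"
    then have "\<exists>c. three_rainbow_coloring V E (card V - 2) c"
      using coloring_not_extremal[OF assms] by blast
    then have "rx3 V E \<le> card V - 2" unfolding rx3_def by (rule Least_le)
    then show False using rx assms(2) by linarith
  qed
next
  assume "tree V E \<or> (unicyclic V E \<and> girth E = 3)"
  then have "card V - 1 \<le> q" if "three_rainbow_coloring V E q c" for q c
  proof
    assume "tree V E" then show ?thesis using tree_colors assms(2) that by blast
  next
    assume U: "unicyclic V E \<and> girth E = 3"
    \<comment> \<open>Girth 3 must yield an actual 3-cycle: an empty infimum would be infinite, and
      a nonempty set of \<open>enat\<close> values attains its infimum.\<close>
    let ?L = "(\<lambda>p. enat (length p)) ` {p. cycle E p}"
    have "?L \<noteq> {}"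
    proof
      assume "?L = {}"
      then have "girth E = \<infinity>" by (simp only: girth_def Inf_empty top_enat_def)
      then show False using U by simp
    qed
    then have "Inf ?L \<in> ?L" using wellorder_InfI[of _ ?L] by fast
    then have "3 \<in> ?L" using U by (simp add: girth_def)
    then obtain p where p: "cycle E p" "length p = 3" by (auto simp: numeral_eq_enat)
    then show ?thesis
      using unicyclic_triangle_colors[OF assms that _ cycle_3_triangle[OF p]] U
      by (simp add: unicyclic_def)
  qed
  then show "rx3 V E = card V - 1"
    unfolding rx3_def using coloring_order_minus_one[OF assms]
    by (intro Least_equality) auto
qed

end
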